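(* Let $T \ge 1$, let $\alpha>0$, and let $\mathcal{K} \subseteq \mathbb{R}^{m\times n}$ be convex and compact. Let $l_1,\ldots,l_T$ be independent random functions $l_t:\mathbb{R}^{m\times n}\to\mathbb{R}$ such that $\mathbb{E}[l_t]$ is $\alpha$-strongly convex for all $t=1,\ldots,T$. Let $\tilde\nabla_t$ be a derivative oracle that is consistent, i.e. its output $\tilde\nabla_t$ at $K$ satisfies $\mathbb{E}[\tilde\nabla_t]=\frac{\partial}{\partial K}\mathbb{E}[l_t(K)]$, and has bounded variance, i.e. $\mathbb{E}\left[\|\tilde\nabla_t\|_F^2\right]\le b_t^2$, for all $K\in\mathcal{K}$. Set the step sizes $\eta_t=\frac{1}{\alpha t}$. Let $K^\star=\operatorname{argmin}_{K\in\mathcal{K}}\sum_{t=1}^T l_t(K)$. Then Online Gradient Descent, i.e. the iteration started at some $K_1\in\mathcal{K}$ with $$K_{t+1}=\Pi_{\mathcal{K}}\left(K_t-\eta_t\tilde\nabla_t\right),$$ where $\tilde\nabla_t$ is the output of the oracle at $K_t$, has expected regret $$\mathbb{E}\left[\sum_{t=1}^T\left(l_t(K_t)-l_t(K^\star)\right)\right]\le\frac12\sum_{t=1}^T\frac{b_t^2}{\alpha t}.$$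
   Context: $\langle A,B\rangle_F=\operatorname{Tr}A^\top B$ is the Frobenius inner product and $\|A\|_F=\sqrt{\langle A,A\rangle_F}$ the Frobenius norm. $\Pi_{\mathcal{K}}$ denotes the projection onto $\mathcal{K}$. The matrix derivative of a differentiable $f:\mathbb{R}^{m\times n}\to\mathbb{R}$ is the matrix with entries $\left[\frac{\partial}{\partial X}f(X)\right]_{ij}=\partial f(X)/\partial X_{i,j}$. A differentiable function $f:\mathcal{X}\subseteq\mathbb{R}^{m\times n}\to\mathbb{R}$ is strongly convex with coefficient $\alpha$ ($\alpha$-strongly convex) if for all $X,Y\in\mathcal{X}$, $$f(X)-f(Y)\le\left\langle\frac{\partial}{\partial X}f(X),X-Y\right\rangle_F-\frac{\alpha}{2}\|X-Y\|_F^2.$$ $\mathbb{E}[l_t]$ denotes the function $K\mapsto\mathbb{E}[l_t(K)]$. A derivative oracle returns, at round $t$ and when queried at a point $K$, a random matrix $\tilde\nabla_t\in\mathbb{R}^{m\times n}$. At each round $t$ the point $K_t$ is played, the loss $l_t(K_t)$ is incurred, and the update is performed.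
   Formalization: K* is taken as a fixed minimiser over K of the expected sum of E[l_t], not of the realised random sum, and the pairs (loss, oracle output) are assumed independent across rounds, not only the losses; without these the stated bound is false. *)

theory Defs
  imports "HOL-Probability.Probability"
begin

text \<open>
  Matrices with rows indexed by \<open>'m\<close> and columns by \<open>'n\<close> have type \<open>real^'n^'m\<close>.
\<close>

definition frob_inner :: "real^'n^'m \<Rightarrow> real^'n^'m \<Rightarrow> real" where
  "frob_inner A B = trace (transpose A ** B)"

definition frob_norm :: "real^'n^'m \<Rightarrow> real" where
  "frob_norm A = sqrt (frob_inner A A)"

text \<open>
  The following two facts show that the metric of the type \<open>real^'n^'m\<close>, and hence the library
  projection \<open>closest_point\<close>, is the one of the Frobenius norm.
\<close>

lemma frob_inner_eq_inner: "frob_inner A B = inner A B"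
proof -
  have "frob_inner A B = (\<Sum>j\<in>UNIV. \<Sum>i\<in>UNIV. A $ i $ j * B $ i $ j)"
    by (simp add: frob_inner_def trace_def transpose_def matrix_matrix_mult_def)
  also have "\<dots> = (\<Sum>i\<in>UNIV. \<Sum>j\<in>UNIV. A $ i $ j * B $ i $ j)"
    by (rule sum.swap)
  also have "\<dots> = inner A B"
    by (simp add: inner_vec_def)
  finally show ?thesis .
qed

lemma frob_norm_eq_norm: "frob_norm A = norm A"
  by (simp add: frob_norm_def frob_inner_eq_inner norm_eq_sqrt_inner)

text \<open>
  The \<open>(i,j)\<close> entry is the partial derivative with respect to the \<open>(i,j)\<close> entry of the argument;
  \<open>axis i (axis j 1)\<close> is the matrix unit.
\<close>

definition matrix_deriv :: "(real^'n^'m \<Rightarrow> real) \<Rightarrow> real^'n^'m \<Rightarrow> real^'n^'m" where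
  "matrix_deriv f X = (\<chi> i j. deriv (\<lambda>h. f (X + h *\<^sub>R axis i (axis j 1))) 0)"

text \<open>
  Differentiability is required in full neighbourhoods of the points of \<open>S\<close>, so that all partial
  derivatives make sense there.
\<close>

definition strongly_convex_on :: "real \<Rightarrow> (real^'n^'m) set \<Rightarrow> (real^'n^'m \<Rightarrow> real) \<Rightarrow> bool" where
  "strongly_convex_on \<alpha> S f \<longleftrightarrow>
     (\<forall>X\<in>S. f differentiable (at X)) \<and>
     (\<forall>X\<in>S. \<forall>Y\<in>S.
        f X - f Y \<le> frob_inner (matrix_deriv f X) (X - Y) - \<alpha> / 2 * (frob_norm (X - Y))\<^sup>2)"

text \<open>
  A random function \<open>X i\<close> maps an outcome \<open>\<omega>\<close> and an argument \<open>k\<close> to a value. The random functions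
  are independent if they are driven by independent sources of randomness: there are
  independent \<open>\<sigma>\<close>-algebras \<open>F i\<close> with \<open>X i\<close> jointly measurable with respect to \<open>F i\<close> and the
  Borel sets. Independence of the cylinder \<open>\<sigma>\<close>-algebras generated by the evaluations \<open>X i \<omega> k\<close> at
  fixed \<open>k\<close> would say nothing about evaluations at random arguments: for \<open>U\<close> with a continuous
  distribution, the evaluations of \<open>\<lambda>\<omega> k. indicator {U \<omega>} k\<close> are all almost surely zero.
\<close>

definition (in prob_space) indep_random_functions ::
  "'i set \<Rightarrow> ('i \<Rightarrow> 'a \<Rightarrow> 'k::topological_space \<Rightarrow> 'v::topological_space) \<Rightarrow> bool" where
  "indep_random_functions I X \<longleftrightarrow>
     (\<exists>F. (\<forall>i\<in>I. subalgebra M (F i)) \<and>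
          indep_sets (\<lambda>i. sets (F i)) I \<and>
          (\<forall>i\<in>I. (\<lambda>(\<omega>, k). X i \<omega> k) \<in> borel_measurable (F i \<Otimes>\<^sub>M borel)))"

end

theory Submission imports Defs begin

text \<open>
  For deterministic gradients the bound is a telescoping computation. Projecting onto a convex set
  does not increase the distance to a comparator \<open>u\<close> in that set, so round \<open>t\<close> changes
  \<open>\<parallel>K t - u\<parallel>\<^sup>2\<close> by at most \<open>- 2 * \<eta> t * \<langle>G t, K t - u\<rangle> + (\<eta> t)\<^sup>2 * \<parallel>G t\<parallel>\<^sup>2\<close>
  (\<open>projected_gradient_step\<close>). Strong convexity bounds the regret of the round by
  \<open>\<langle>G t, K t - u\<rangle> - \<alpha> / 2 * \<parallel>K t - u\<parallel>\<^sup>2\<close>. For \<open>\<eta> t = 1 / (\<alpha> * t)\<close> the squared distances of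
  consecutive rounds match and add up to a nonpositive number (\<open>sum_weighted_telescope\<close>), and only
  the second-order terms \<open>\<eta> t / 2 * \<parallel>G t\<parallel>\<^sup>2\<close> remain.

  What makes the argument survive randomness is that \<open>K t\<close> is determined by the rounds before \<open>t\<close>,
  hence independent of the source driving \<open>l t\<close> and \<open>G t\<close>. The joint law of past and present is
  then a product measure, and by Fubini the expectation of a quantity depending on both may be taken
  with \<open>K t\<close> frozen first (\<open>integral_freeze\<close>). This turns the oracle output at \<open>K t\<close> into
  the gradient of the expected loss (\<open>integral_inner_freeze\<close>) and bounds its second moment
  (\<open>integral_sq_freeze_le\<close>).

  The delicate point is the loss \<open>l t \<omega> (K t \<omega>)\<close>, which need not be integrable although every
  \<open>l t \<omega> X\<close> with fixed \<open>X\<close> is: nothing controls \<open>E \<bar>l t X\<bar>\<close> uniformly in \<open>X\<close>. If the total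
  regret is not integrable, its integral is \<open>0\<close> by convention and the bound is trivial. If it is
  integrable, then so are all the partial sums, by the mechanism that makes a discrete-time local
  martingale with integrable terminal value a martingale: integrating out the last round of an
  integrable sum leaves the preceding partial sum plus a bounded term, and Fubini says that the
  result is integrable again. The expectation can thus be evaluated round by round from the end
  (\<open>integral_sum_freeze\<close>).
\<close>

section \<open>Freezing an independent argument\<close>

context prob_space begin

lemma measurable_ident_subalg: "subalgebra N A \<Longrightarrow> (\<lambda>\<omega>. \<omega>) \<in> N \<rightarrow>\<^sub>M A"
  by (auto simp: subalgebra_def measurable_def intro!: sets.Int)

text \<open>
  Independence of two sub-\<open>\<sigma>\<close>-algebras is independence of the identity map seen as a random variable
  into either of them. The right-hand side is the product of the two restrictions of \<open>M\<close>.
\<close>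

lemma distr_diagonal_indep:
  assumes A: "subalgebra M A" and B: "subalgebra M B" and AB: "indep_set (sets A) (sets B)"
  shows "distr M (A \<Otimes>\<^sub>M B) (\<lambda>\<omega>. (\<omega>, \<omega>)) = distr M A (\<lambda>\<omega>. \<omega>) \<Otimes>\<^sub>M distr M B (\<lambda>\<omega>. \<omega>)"
proof -
  have sigma: "sigma_sets (space M) {(\<lambda>\<omega>. \<omega>) -` X \<inter> space M |X. X \<in> sets N} = sets N"
    if "subalgebra M N" for N
  proof -
    have "space N = space M" using that by (simp add: subalgebra_def)
    then have "{(\<lambda>\<omega>. \<omega>) -` X \<inter> space M |X. X \<in> sets N} = sets N"
      using sets.sets_into_space[of _ N] by (auto simp: Int_absorb2)
    then show ?thesis using sets.sigma_sets_eq[of N] \<open>space N = space M\<close> by simp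
  qed
  have "indep_var A (\<lambda>\<omega>. \<omega>) B (\<lambda>\<omega>. \<omega>)"
    unfolding indep_var_eq sigma[OF A] sigma[OF B] using A B AB
    by (simp add: measurable_ident_subalg)
  then show ?thesis by (simp add: indep_var_distribution_eq)
qed

text \<open>
  The two occurrences of the outcome are separated: in \<open>\<phi> \<omega> \<omega>'\<close>, the first argument carries the
  \<open>A\<close>-measurable dependence and the second the \<open>B\<close>-measurable one. Since the law of the diagonal is a
  product measure, these are the theorems of Tonelli and Fubini. For Bochner integrals, integrability
  on the diagonal is the hypothesis from which integrability of the partial integral is obtained.
\<close>

lemma
  assumes A: "subalgebra M A" and B: "subalgebra M B" and AB: "indep_set (sets A) (sets B)"
  shows nn_integral_freeze:
    "\<And>\<phi>. (\<lambda>(\<omega>, \<omega>'). \<phi> \<omega> \<omega>') \<in> borel_measurable (A \<Otimes>\<^sub>M B) \<Longrightarrow>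
       (\<integral>\<^sup>+\<omega>. \<phi> \<omega> \<omega> \<partial>M) = (\<integral>\<^sup>+\<omega>. \<integral>\<^sup>+\<omega>'. \<phi> \<omega> \<omega>' \<partial>M \<partial>M)"
    and integrable_freeze:
    "\<And>\<phi> :: 'a \<Rightarrow> 'a \<Rightarrow> real. (\<lambda>(\<omega>, \<omega>'). \<phi> \<omega> \<omega>') \<in> borel_measurable (A \<Otimes>\<^sub>M B) \<Longrightarrow>
       integrable M (\<lambda>\<omega>. \<phi> \<omega> \<omega>) \<Longrightarrow> integrable M (\<lambda>\<omega>. \<integral>\<omega>'. \<phi> \<omega> \<omega>' \<partial>M)"
    and integral_freeze:
    "\<And>\<phi> :: 'a \<Rightarrow> 'a \<Rightarrow> real. (\<lambda>(\<omega>, \<omega>'). \<phi> \<omega> \<omega>') \<in> borel_measurable (A \<Otimes>\<^sub>M B) \<Longrightarrow>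
       integrable M (\<lambda>\<omega>. \<phi> \<omega> \<omega>) \<Longrightarrow> (\<integral>\<omega>. \<phi> \<omega> \<omega> \<partial>M) = (\<integral>\<omega>. \<integral>\<omega>'. \<phi> \<omega> \<omega>' \<partial>M \<partial>M)"
proof -
  let ?P = "distr M A (\<lambda>\<omega>. \<omega>)" and ?Q = "distr M B (\<lambda>\<omega>. \<omega>)"
  have mA: "(\<lambda>\<omega>. \<omega>) \<in> M \<rightarrow>\<^sub>M A" and mB: "(\<lambda>\<omega>. \<omega>) \<in> M \<rightarrow>\<^sub>M B"
    using A B by (auto intro: measurable_ident_subalg)
  have mD: "(\<lambda>\<omega>. (\<omega>, \<omega>)) \<in> M \<rightarrow>\<^sub>M A \<Otimes>\<^sub>M B" using mA mB by (rule measurable_Pair)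
  have sp: "space A = space M" using A by (simp add: subalgebra_def)
  interpret P: prob_space ?P by (rule prob_space_distr[OF mA])
  interpret Q: prob_space ?Q by (rule prob_space_distr[OF mB])
  interpret PQ: pair_sigma_finite ?P ?Q ..
  note law = distr_diagonal_indep[OF A B AB]
  show "(\<integral>\<^sup>+\<omega>. \<phi> \<omega> \<omega> \<partial>M) = (\<integral>\<^sup>+\<omega>. \<integral>\<^sup>+\<omega>'. \<phi> \<omega> \<omega>' \<partial>M \<partial>M)"
    if \<phi>: "(\<lambda>(\<omega>, \<omega>'). \<phi> \<omega> \<omega>') \<in> borel_measurable (A \<Otimes>\<^sub>M B)" for \<phi>
  proof -
    have \<phi>': "(\<lambda>(\<omega>, \<omega>'). \<phi> \<omega> \<omega>') \<in> borel_measurable (?P \<Otimes>\<^sub>M ?Q)" using \<phi> by simp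
    have "(\<integral>\<^sup>+\<omega>. \<phi> \<omega> \<omega> \<partial>M) = (\<integral>\<^sup>+p. (case p of (\<omega>, \<omega>') \<Rightarrow> \<phi> \<omega> \<omega>') \<partial>(?P \<Otimes>\<^sub>M ?Q))"
      unfolding law[symmetric] using \<phi> by (subst nn_integral_distr[OF mD]) auto
    also have "\<dots> = (\<integral>\<^sup>+\<omega>. \<integral>\<^sup>+\<omega>'. \<phi> \<omega> \<omega>' \<partial>?Q \<partial>?P)"
      using Q.nn_integral_fst[OF \<phi>'] by simp
    also have "\<dots> = (\<integral>\<^sup>+\<omega>. \<integral>\<^sup>+\<omega>'. \<phi> \<omega> \<omega>' \<partial>?Q \<partial>M)"
      using Q.borel_measurable_nn_integral_fst[OF \<phi>'] by (subst nn_integral_distr[OF mA]) auto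
    also have "\<dots> = (\<integral>\<^sup>+\<omega>. \<integral>\<^sup>+\<omega>'. \<phi> \<omega> \<omega>' \<partial>M \<partial>M)"
    proof (rule nn_integral_cong)
      fix \<omega> assume "\<omega> \<in> space M"
      then have "\<phi> \<omega> \<in> borel_measurable B"
        using measurable_Pair2[OF \<phi>, of \<omega>] sp by simp
      then show "(\<integral>\<^sup>+\<omega>'. \<phi> \<omega> \<omega>' \<partial>?Q) = (\<integral>\<^sup>+\<omega>'. \<phi> \<omega> \<omega>' \<partial>M)"
        by (subst nn_integral_distr[OF mB]) auto
    qed
    finally show ?thesis .
  qed
  show "integrable M (\<lambda>\<omega>. \<integral>\<omega>'. \<phi> \<omega> \<omega>' \<partial>M)"
       "(\<integral>\<omega>. \<phi> \<omega> \<omega> \<partial>M) = (\<integral>\<omega>. \<integral>\<omega>'. \<phi> \<omega> \<omega>' \<partial>M \<partial>M)"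
    if \<phi>: "(\<lambda>(\<omega>, \<omega>'). \<phi> \<omega> \<omega>') \<in> borel_measurable (A \<Otimes>\<^sub>M B)"
    and int: "integrable M (\<lambda>\<omega>. \<phi> \<omega> \<omega>)" for \<phi> :: "'a \<Rightarrow> 'a \<Rightarrow> real"
  proof -
    have \<phi>': "integrable (?P \<Otimes>\<^sub>M ?Q) (\<lambda>(\<omega>, \<omega>'). \<phi> \<omega> \<omega>')"
      unfolding law[symmetric] using \<phi> int by (subst integrable_distr_eq[OF mD]) auto
    have inner: "(\<integral>\<omega>'. \<phi> \<omega> \<omega>' \<partial>?Q) = (\<integral>\<omega>'. \<phi> \<omega> \<omega>' \<partial>M)" if "\<omega> \<in> space M" for \<omega>
    proof -
      have "\<phi> \<omega> \<in> borel_measurable B"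
        using that measurable_Pair2[OF \<phi>, of \<omega>] sp by simp
      then show ?thesis by (subst integral_distr[OF mB]) auto
    qed
    have fst: "integrable ?P (\<lambda>\<omega>. \<integral>\<omega>'. \<phi> \<omega> \<omega>' \<partial>?Q)"
      using PQ.integrable_fst'[OF \<phi>'] by simp
    then have "integrable M (\<lambda>\<omega>. \<integral>\<omega>'. \<phi> \<omega> \<omega>' \<partial>?Q)"
      by (rule integrable_distr[OF mA])
    then show "integrable M (\<lambda>\<omega>. \<integral>\<omega>'. \<phi> \<omega> \<omega>' \<partial>M)"
      by (simp add: inner cong: Bochner_Integration.integrable_cong)
    have "(\<integral>\<omega>. \<phi> \<omega> \<omega> \<partial>M) = (\<integral>p. (case p of (\<omega>, \<omega>') \<Rightarrow> \<phi> \<omega> \<omega>') \<partial>(?P \<Otimes>\<^sub>M ?Q))"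
      unfolding law[symmetric] using \<phi> by (subst integral_distr[OF mD]) auto
    also have "\<dots> = (\<integral>\<omega>. \<integral>\<omega>'. \<phi> \<omega> \<omega>' \<partial>?Q \<partial>?P)"
      using PQ.integral_fst'[OF \<phi>'] by simp
    also have "\<dots> = (\<integral>\<omega>. \<integral>\<omega>'. \<phi> \<omega> \<omega>' \<partial>?Q \<partial>M)"
      using borel_measurable_integrable[OF fst] by (subst integral_distr[OF mA]) auto
    also have "\<dots> = (\<integral>\<omega>. \<integral>\<omega>'. \<phi> \<omega> \<omega>' \<partial>M \<partial>M)"
      by (rule Bochner_Integration.integral_cong) (auto simp: inner)
    finally show "(\<integral>\<omega>. \<phi> \<omega> \<omega> \<partial>M) = (\<integral>\<omega>. \<integral>\<omega>'. \<phi> \<omega> \<omega>' \<partial>M \<partial>M)" .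
  qed
qed

section \<open>Joint \<open>\<sigma>\<close>-algebras of independent sources\<close>

definition joint_sigma :: "('i \<Rightarrow> 'a measure) \<Rightarrow> 'i set \<Rightarrow> 'a measure" where
  "joint_sigma F J = sigma (space M) (\<Union>i\<in>J. sets (F i))"

lemma
  assumes "\<And>i. i \<in> J \<Longrightarrow> subalgebra M (F i)"
  shows space_joint: "space (joint_sigma F J) = space M"
    and sets_joint: "sets (joint_sigma F J) = sigma_sets (space M) (\<Union>i\<in>J. sets (F i))"
    and subalgebra_joint: "subalgebra M (joint_sigma F J)"
proof -
  have sub: "(\<Union>i\<in>J. sets (F i)) \<subseteq> sets M"
    using assms by (fastforce simp: subalgebra_def)
  then have pow: "(\<Union>i\<in>J. sets (F i)) \<subseteq> Pow (space M)"
    using sets.space_closed by blast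
  show sp: "space (joint_sigma F J) = space M"
    unfolding joint_sigma_def by (rule space_measure_of[OF pow])
  show st: "sets (joint_sigma F J) = sigma_sets (space M) (\<Union>i\<in>J. sets (F i))"
    unfolding joint_sigma_def by (rule sets_measure_of[OF pow])
  show "subalgebra M (joint_sigma F J)"
    unfolding subalgebra_def sp st using sub by (simp add: sets.sigma_sets_subset)
qed

lemma joint_mono:
  assumes "\<And>i. i \<in> J \<Longrightarrow> subalgebra M (F i)" and "J' \<subseteq> J"
  shows "subalgebra (joint_sigma F J) (joint_sigma F J')"
proof -
  have "\<And>i. i \<in> J' \<Longrightarrow> subalgebra M (F i)" using assms by blast
  moreover have "(\<Union>i\<in>J'. sets (F i)) \<subseteq> (\<Union>i\<in>J. sets (F i))" using assms(2) by blast
  ultimately show ?thesis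
    using assms(1)
    by (simp add: subalgebra_def[of "joint_sigma F J"] space_joint sets_joint sigma_sets_mono')
qed

lemma subalgebra_joint_source:
  assumes "\<And>i. i \<in> J \<Longrightarrow> subalgebra M (F i)" and "j \<in> J"
  shows "subalgebra (joint_sigma F J) (F j)"
  using assms unfolding subalgebra_def
  by (auto simp: space_joint[of J] sets_joint[of J] subalgebra_def)

lemma indep_joint_source:
  assumes sub: "\<And>i. i \<in> I \<Longrightarrow> subalgebra M (F i)"
    and ind: "indep_sets (\<lambda>i. sets (F i)) I"
    and J: "J \<subseteq> I" and j: "j \<in> I" "j \<notin> J"
  shows "indep_set (sets (joint_sigma F J)) (sets (F j))"
proof -
  let ?I = "case_bool J {j}"
  have "indep_sets (\<lambda>i. sets (F i)) (\<Union>c\<in>UNIV. ?I c)"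
    using J j by (intro indep_sets_mono_index[OF _ ind]) (auto split: bool.splits)
  then have "indep_sets (\<lambda>c. sigma_sets (space M) (\<Union>i\<in>?I c. sets (F i))) UNIV"
    by (rule indep_sets_collect_sigma)
       (use j in \<open>auto simp: disjoint_family_on_def sets.Int_stable split: bool.splits\<close>)
  moreover have "sigma_sets (space M) (sets (F j)) = sets (F j)"
    using sets.sigma_sets_eq[of "F j"] sub[OF j(1)] by (simp add: subalgebra_def)
  moreover have "sets (joint_sigma F J) = sigma_sets (space M) (\<Union>i\<in>J. sets (F i))"
    using J sub by (intro sets_joint) blast
  ultimately have "(\<lambda>c. sigma_sets (space M) (\<Union>i\<in>?I c. sets (F i))) =
      case_bool (sets (joint_sigma F J)) (sets (F j))"
    by (auto simp: fun_eq_iff split: bool.splits)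
  with \<open>indep_sets (\<lambda>c. sigma_sets (space M) (\<Union>i\<in>?I c. sets (F i))) UNIV\<close>
  show ?thesis unfolding indep_set_def by simp
qed

section \<open>Evaluating independent random functions at points determined by the past\<close>

text \<open>
  A second moment bound that is uniform over the deterministic arguments in \<open>C\<close> passes to the random
  argument \<open>X\<close> by Tonelli. Together with the boundedness of \<open>C\<close> it makes the inner product with
  \<open>X - u\<close> integrable, so that Fubini replaces \<open>H\<close> by its mean.
\<close>

lemma
  fixes H :: "'a \<Rightarrow> 'v::euclidean_space \<Rightarrow> 'v" and X :: "'a \<Rightarrow> 'v"
  assumes A: "subalgebra M A" and B: "subalgebra M B" and AB: "indep_set (sets A) (sets B)"
    and H: "(\<lambda>(\<omega>, k). H \<omega> k) \<in> borel_measurable (B \<Otimes>\<^sub>M borel)"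
    and X: "X \<in> borel_measurable A" and XC: "\<And>\<omega>. \<omega> \<in> space M \<Longrightarrow> X \<omega> \<in> C"
    and C: "bounded C" 
    and int: "\<And>k. k \<in> C \<Longrightarrow> integrable M (\<lambda>\<omega>. H \<omega> k)"
    and sq_int: "\<And>k. k \<in> C \<Longrightarrow> integrable M (\<lambda>\<omega>. (norm (H \<omega> k))\<^sup>2)"
    and sq_le: "\<And>k. k \<in> C \<Longrightarrow> (\<integral>\<omega>. (norm (H \<omega> k))\<^sup>2 \<partial>M) \<le> c"
  shows integrable_sq_freeze: "integrable M (\<lambda>\<omega>. (norm (H \<omega> (X \<omega>)))\<^sup>2)"
    and integral_sq_freeze_le: "(\<integral>\<omega>. (norm (H \<omega> (X \<omega>)))\<^sup>2 \<partial>M) \<le> c"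
    and integrable_inner_sample: "integrable M (\<lambda>\<omega>. inner (H \<omega> (X \<omega>)) (X \<omega> - u))"
    and integrable_inner_mean: "integrable M (\<lambda>\<omega>. inner (\<integral>\<omega>'. H \<omega>' (X \<omega>) \<partial>M) (X \<omega> - u))"
    and integral_inner_freeze:
      "(\<integral>\<omega>. inner (H \<omega> (X \<omega>)) (X \<omega> - u) \<partial>M) =
       (\<integral>\<omega>. inner (\<integral>\<omega>'. H \<omega>' (X \<omega>) \<partial>M) (X \<omega> - u) \<partial>M)"
proof -
  have mX2: "(\<lambda>p. X (fst p)) \<in> borel_measurable (A \<Otimes>\<^sub>M B)" using X by measurable
  have mH: "(\<lambda>(\<omega>, \<omega>'). H \<omega>' (X \<omega>)) \<in> borel_measurable (A \<Otimes>\<^sub>M B)"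
    using measurable_compose[OF measurable_Pair[OF measurable_snd mX2] H]
    by (simp add: case_prod_beta')
  have mX[measurable]: "X \<in> borel_measurable M" by (rule measurable_from_subalg[OF A X])
  have [measurable]: "(\<lambda>\<omega>. H \<omega> (X \<omega>)) \<in> borel_measurable M"
    using measurable_compose[OF measurable_Pair[OF measurable_ident_subalg[OF B] mX] H] by simp
  have "(\<integral>\<^sup>+\<omega>. ennreal ((norm (H \<omega> (X \<omega>)))\<^sup>2) \<partial>M) =
      (\<integral>\<^sup>+\<omega>. \<integral>\<^sup>+\<omega>'. ennreal ((norm (H \<omega>' (X \<omega>)))\<^sup>2) \<partial>M \<partial>M)"
    using mH by (intro nn_integral_freeze[OF A B AB]) (simp add: case_prod_beta')
  also have "\<dots> \<le> (\<integral>\<^sup>+\<omega>. ennreal c \<partial>M)"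
  proof (rule nn_integral_mono)
    fix \<omega> assume "\<omega> \<in> space M"
    then show "(\<integral>\<^sup>+\<omega>'. ennreal ((norm (H \<omega>' (X \<omega>)))\<^sup>2) \<partial>M) \<le> ennreal c"
      using sq_int sq_le XC by (simp add: nn_integral_eq_integral ennreal_leI)
  qed
  finally have nn: "(\<integral>\<^sup>+\<omega>. ennreal ((norm (H \<omega> (X \<omega>)))\<^sup>2) \<partial>M) \<le> ennreal c"
    by (simp add: emeasure_space_1)
  then show sq: "integrable M (\<lambda>\<omega>. (norm (H \<omega> (X \<omega>)))\<^sup>2)"
    by (intro integrableI_bounded) (auto intro: le_less_trans)
  (* A value of X lies in C and witnesses 0 \<le> c, so that ennreal c does not truncate c. *)
  obtain \<omega>0 where "\<omega>0 \<in> space M" using not_empty by blast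
  have "0 \<le> (\<integral>\<omega>. (norm (H \<omega> (X \<omega>0)))\<^sup>2 \<partial>M)" by simp
  also have "\<dots> \<le> c" using sq_le XC \<open>\<omega>0 \<in> space M\<close> by blast
  finally have "0 \<le> c" .
  then show "(\<integral>\<omega>. (norm (H \<omega> (X \<omega>)))\<^sup>2 \<partial>M) \<le> c"
    using nn sq by (simp add: nn_integral_eq_integral)
  obtain D where D: "\<And>k. k \<in> C \<Longrightarrow> norm k \<le> D" using C unfolding bounded_iff by blast
  show inner: "integrable M (\<lambda>\<omega>. inner (H \<omega> (X \<omega>)) (X \<omega> - u))"
  proof (rule Bochner_Integration.integrable_bound)
    show "integrable M (\<lambda>\<omega>. (norm (H \<omega> (X \<omega>)))\<^sup>2 + (D + norm u)\<^sup>2)" using sq by simp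
    show "AE \<omega> in M. norm (inner (H \<omega> (X \<omega>)) (X \<omega> - u))
        \<le> norm ((norm (H \<omega> (X \<omega>)))\<^sup>2 + (D + norm u)\<^sup>2)"
    proof (rule AE_I2)
      fix \<omega> assume "\<omega> \<in> space M"
      have "norm (X \<omega> - u) \<le> norm (X \<omega>) + norm u" by (rule norm_triangle_ineq4)
      then have le: "norm (X \<omega> - u) \<le> D + norm u" using D[OF XC[OF \<open>\<omega> \<in> space M\<close>]] by simp
      have "\<bar>inner (H \<omega> (X \<omega>)) (X \<omega> - u)\<bar> \<le> norm (H \<omega> (X \<omega>)) * norm (X \<omega> - u)"
        by (rule Cauchy_Schwarz_ineq2)
      also have "\<dots> \<le> norm (H \<omega> (X \<omega>)) * (D + norm u)" using le by (simp add: mult_left_mono)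
      also have "\<dots> \<le> (norm (H \<omega> (X \<omega>)))\<^sup>2 + (D + norm u)\<^sup>2"
        using sum_squares_bound[of "norm (H \<omega> (X \<omega>))" "D + norm u"]
          norm_ge_zero[of "H \<omega> (X \<omega>)"] order_trans[OF norm_ge_zero le]
          mult_nonneg_nonneg[of "norm (H \<omega> (X \<omega>))" "D + norm u"] by linarith
      finally show "norm (inner (H \<omega> (X \<omega>)) (X \<omega> - u))
        \<le> norm ((norm (H \<omega> (X \<omega>)))\<^sup>2 + (D + norm u)\<^sup>2)" by simp
    qed
  qed simp
  have m: "(\<lambda>(\<omega>, \<omega>'). inner (H \<omega>' (X \<omega>)) (X \<omega> - u)) \<in> borel_measurable (A \<Otimes>\<^sub>M B)"
    using mH mX2 by (simp add: case_prod_beta')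
  have eq: "(\<integral>\<omega>'. inner (H \<omega>' (X \<omega>)) (X \<omega> - u) \<partial>M) = inner (\<integral>\<omega>'. H \<omega>' (X \<omega>) \<partial>M) (X \<omega> - u)"
    if "\<omega> \<in> space M" for \<omega>
    using int[OF XC[OF that]] by simp
  show "integrable M (\<lambda>\<omega>. inner (\<integral>\<omega>'. H \<omega>' (X \<omega>) \<partial>M) (X \<omega> - u))"
    using integrable_freeze[OF A B AB m inner]
    by (simp add: eq cong: Bochner_Integration.integrable_cong)
  show "(\<integral>\<omega>. inner (H \<omega> (X \<omega>)) (X \<omega> - u) \<partial>M) =
       (\<integral>\<omega>. inner (\<integral>\<omega>'. H \<omega>' (X \<omega>) \<partial>M) (X \<omega> - u) \<partial>M)"
    using integral_freeze[OF A B AB m inner]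
    by (simp add: eq cong: Bochner_Integration.integral_cong)
qed

lemma integrable_continuous_compact:
  fixes f :: "'v::euclidean_space \<Rightarrow> real"
  assumes "continuous_on UNIV f" "X \<in> borel_measurable M" "compact C"
    and "\<And>\<omega>. \<omega> \<in> space M \<Longrightarrow> X \<omega> \<in> C"
  shows "integrable M (\<lambda>\<omega>. f (X \<omega>))"
proof -
  have "bounded (f ` C)"
    by (intro compact_imp_bounded compact_continuous_image continuous_on_subset[OF assms(1)] assms(3))
      simp
  then obtain B where "\<And>k. k \<in> C \<Longrightarrow> norm (f k) \<le> B"
    by (auto simp: bounded_iff)
  then have "AE \<omega> in M. norm (f (X \<omega>)) \<le> B"
    using assms(4) by (intro AE_I2) blast
  moreover have "(\<lambda>\<omega>. f (X \<omega>)) \<in> borel_measurable M"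
    by (rule measurable_compose[OF assms(2) borel_measurable_continuous_onI[OF assms(1)]])
  ultimately show ?thesis by (rule integrable_const_bound)
qed

text \<open>
  Only the whole sum is assumed integrable, not its terms. For fixed \<open>\<omega>\<close>, the partial sum
  over the rounds before the last is a constant with respect to the source of the last round, so that
  freezing yields an integrable function equal to this partial sum plus the conditional mean of the
  last term. The mean is integrable, hence so is the partial sum, and the induction continues.
\<close>

lemma integral_sum_freeze:
  fixes h :: "nat \<Rightarrow> 'a \<Rightarrow> 'v::euclidean_space \<Rightarrow> real" and X :: "nat \<Rightarrow> 'a \<Rightarrow> 'v"
  assumes sub: "\<And>t. t \<in> {1..n} \<Longrightarrow> subalgebra M (F t)"
    and ind: "indep_sets (\<lambda>t. sets (F t)) {1..n}"
    and h: "\<And>t. t \<in> {1..n} \<Longrightarrow> (\<lambda>(\<omega>, k). h t \<omega> k) \<in> borel_measurable (F t \<Otimes>\<^sub>M borel)"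
    and X: "\<And>t. t \<in> {1..n} \<Longrightarrow> X t \<in> borel_measurable (joint_sigma F {1..<t})"
    and h_int: "\<And>t k. t \<in> {1..n} \<Longrightarrow> integrable M (\<lambda>\<omega>. h t \<omega> k)"
    and mean_int: "\<And>t. t \<in> {1..n} \<Longrightarrow> integrable M (\<lambda>\<omega>. \<integral>\<omega>'. h t \<omega>' (X t \<omega>) \<partial>M)"
    and "integrable M (\<lambda>\<omega>. \<Sum>t=1..n. h t \<omega> (X t \<omega>))"
  shows "(\<integral>\<omega>. (\<Sum>t=1..n. h t \<omega> (X t \<omega>)) \<partial>M) = (\<Sum>t=1..n. \<integral>\<omega>. \<integral>\<omega>'. h t \<omega>' (X t \<omega>) \<partial>M \<partial>M)"
  using assms
proof (induction n)
  case 0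
  then show ?case by simp
next
  case (Suc n)
  note sub = Suc.prems(1) and h = Suc.prems(3) and X = Suc.prems(4)
  let ?N = "Suc n" and ?A = "joint_sigma F {1..n}" and ?S = "\<lambda>\<omega>. \<Sum>t=1..n. h t \<omega> (X t \<omega>)"
  let ?g = "\<lambda>\<omega>. \<integral>\<omega>'. h ?N \<omega>' (X ?N \<omega>) \<partial>M"
  have subn: "subalgebra M (F t)" if "t \<in> {1..n}" for t using that sub by simp
  have A: "subalgebra M ?A" by (intro subalgebra_joint subn)
  have B: "subalgebra M (F ?N)" using sub by simp
  have AB: "indep_set (sets ?A) (sets (F ?N))"
    by (rule indep_joint_source[OF sub Suc.prems(2)]) auto
  have S: "?S \<in> borel_measurable ?A"
  proof (rule borel_measurable_sum)
    fix t assume t: "t \<in> {1..n}"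
    have 1: "X t \<in> borel_measurable ?A"
      by (rule measurable_from_subalg[OF joint_mono[OF subn] X]) (use t in auto)
    have 2: "(\<lambda>\<omega>. \<omega>) \<in> ?A \<rightarrow>\<^sub>M F t"
      by (rule measurable_ident_subalg[OF subalgebra_joint_source[OF subn t]])
    show "(\<lambda>\<omega>. h t \<omega> (X t \<omega>)) \<in> borel_measurable ?A"
      using measurable_compose[OF measurable_Pair[OF 2 1] h] t by simp
  qed
  have XN: "X ?N \<in> borel_measurable ?A" using X[of ?N] by (simp add: atLeastLessThanSuc_atLeastAtMost)
  have XN2: "(\<lambda>p. X ?N (fst p)) \<in> borel_measurable (?A \<Otimes>\<^sub>M F ?N)" using XN by measurable
  have S2: "(\<lambda>p. ?S (fst p)) \<in> borel_measurable (?A \<Otimes>\<^sub>M F ?N)"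
    by (rule measurable_compose[OF measurable_fst S])
  have "(\<lambda>p. h ?N (snd p) (X ?N (fst p))) \<in> borel_measurable (?A \<Otimes>\<^sub>M F ?N)"
    using measurable_compose[OF measurable_Pair[OF measurable_snd XN2] h[of ?N]] by simp
  with S2 have \<phi>: "(\<lambda>(\<omega>, \<omega>'). ?S \<omega> + h ?N \<omega>' (X ?N \<omega>)) \<in> borel_measurable (?A \<Otimes>\<^sub>M F ?N)"
    by (simp only: case_prod_beta') (rule borel_measurable_add)
  have int: "integrable M (\<lambda>\<omega>. ?S \<omega> + h ?N \<omega> (X ?N \<omega>))"
    using Suc.prems(7) by (simp add: add.commute)
  have eq: "(\<integral>\<omega>'. ?S \<omega> + h ?N \<omega>' (X ?N \<omega>) \<partial>M) = ?S \<omega> + ?g \<omega>" for \<omega>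
    using Suc.prems(5)[of ?N "X ?N \<omega>"] by (simp add: prob_space)
  have g: "integrable M ?g" using Suc.prems(6)[of ?N] by simp
  have "integrable M (\<lambda>\<omega>. ?S \<omega> + ?g \<omega>)"
    using integrable_freeze[OF A B AB \<phi> int] unfolding eq .
  from Bochner_Integration.integrable_diff[OF this g] have Sint: "integrable M ?S" by simp
  have "(\<integral>\<omega>. (\<Sum>t=1..?N. h t \<omega> (X t \<omega>)) \<partial>M) = (\<integral>\<omega>. ?S \<omega> + h ?N \<omega> (X ?N \<omega>) \<partial>M)"
    by (simp add: add.commute)
  also have "\<dots> = (\<integral>\<omega>. ?S \<omega> + ?g \<omega> \<partial>M)"
    using integral_freeze[OF A B AB \<phi> int] unfolding eq .
  also have "\<dots> = (\<integral>\<omega>. ?S \<omega> \<partial>M) + (\<integral>\<omega>. ?g \<omega> \<partial>M)"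
    by (rule Bochner_Integration.integral_add[OF Sint g])
  also have "(\<integral>\<omega>. ?S \<omega> \<partial>M) = (\<Sum>t=1..n. \<integral>\<omega>. \<integral>\<omega>'. h t \<omega>' (X t \<omega>) \<partial>M \<partial>M)"
    by (intro Suc.IH Sint subn indep_sets_mono_index[OF _ Suc.prems(2)] h X Suc.prems(5,6)) auto
  finally show ?case by simp
qed

end

section \<open>Projected gradient steps and the regret bound\<close>

lemma projected_gradient_step:
  fixes C :: "'v::euclidean_space set"
  assumes "convex C" "closed C" "u \<in> C"
  shows "(norm (closest_point C (x - \<eta> *\<^sub>R g) - u))\<^sup>2
    \<le> (norm (x - u))\<^sup>2 - 2 * \<eta> * inner g (x - u) + \<eta>\<^sup>2 * (norm g)\<^sup>2"
proof -
  have "dist (closest_point C (x - \<eta> *\<^sub>R g)) (closest_point C u) \<le> dist (x - \<eta> *\<^sub>R g) u"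
    using assms by (intro closest_point_lipschitz) auto
  then have "norm (closest_point C (x - \<eta> *\<^sub>R g) - u) \<le> norm ((x - u) - \<eta> *\<^sub>R g)"
    using assms by (simp add: closest_point_self dist_norm algebra_simps)
  then have "(norm (closest_point C (x - \<eta> *\<^sub>R g) - u))\<^sup>2 \<le> (norm ((x - u) - \<eta> *\<^sub>R g))\<^sup>2"
    by (simp add: power_mono)
  also have "\<dots> = (norm (x - u))\<^sup>2 - 2 * \<eta> * inner g (x - u) + \<eta>\<^sup>2 * (norm g)\<^sup>2"
    by (simp only: power2_norm_eq_inner)
       (simp add: inner_diff_left inner_diff_right inner_commute power2_eq_square algebra_simps)
  finally show ?thesis .
qed

text \<open>
  The weight \<open>t - 1\<close> is what remains of \<open>1 / (\<alpha> * \<eta> t) = t\<close> after strong convexity contributes \<open>- d t\<close>.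
  It vanishes in the first round, so that the initial distance does not enter the bound.
\<close>

lemma sum_weighted_telescope:
  fixes d :: "nat \<Rightarrow> real"
  shows "(\<Sum>t=1..n. (real t - 1) * d t - real t * d (Suc t)) = - real n * d (Suc n)"
  by (induction n) (auto simp: algebra_simps)

theorem theoremV1:
  fixes M :: "'a measure"
    and T :: nat
    and \<alpha> :: real
    and C :: "(real^'n^'m) set"
    and l :: "nat \<Rightarrow> 'a \<Rightarrow> real^'n^'m \<Rightarrow> real"
    and G :: "nat \<Rightarrow> 'a \<Rightarrow> real^'n^'m \<Rightarrow> real^'n^'m"
    and b \<eta> :: "nat \<Rightarrow> real"
    and K :: "nat \<Rightarrow> 'a \<Rightarrow> real^'n^'m"
    and K1 Kstar :: "real^'n^'m"
  assumes "prob_space M"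
    and "T \<ge> 1"
    and "\<alpha> > 0"
    and "convex C" and "compact C"
    and indep: "prob_space.indep_random_functions M {1..T} (\<lambda>t \<omega> X. (l t \<omega> X, G t \<omega> X))"
    and loss_integrable: "\<And>t X. t \<in> {1..T} \<Longrightarrow> integrable M (\<lambda>\<omega>. l t \<omega> X)"
    and strongly_convex:
      "\<And>t. t \<in> {1..T} \<Longrightarrow> strongly_convex_on \<alpha> UNIV (\<lambda>X. \<integral>\<omega>. l t \<omega> X \<partial>M)"
    and oracle_integrable: "\<And>t X. t \<in> {1..T} \<Longrightarrow> X \<in> C \<Longrightarrow> integrable M (\<lambda>\<omega>. G t \<omega> X)"
    and oracle_consistent:
      "\<And>t X. t \<in> {1..T} \<Longrightarrow> X \<in> C \<Longrightarrow>
         (\<integral>\<omega>. G t \<omega> X \<partial>M) = matrix_deriv (\<lambda>Y. \<integral>\<omega>. l t \<omega> Y \<partial>M) X"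
    and oracle_sq_integrable:
      "\<And>t X. t \<in> {1..T} \<Longrightarrow> X \<in> C \<Longrightarrow> integrable M (\<lambda>\<omega>. (frob_norm (G t \<omega> X))\<^sup>2)"
    and oracle_bounded_variance:
      "\<And>t X. t \<in> {1..T} \<Longrightarrow> X \<in> C \<Longrightarrow> (\<integral>\<omega>. (frob_norm (G t \<omega> X))\<^sup>2 \<partial>M) \<le> (b t)\<^sup>2"
    and step_size: "\<And>t. t \<in> {1..T} \<Longrightarrow> \<eta> t = 1 / (\<alpha> * real t)"
    and Kstar: "is_arg_min (\<lambda>X. \<Sum>t=1..T. \<integral>\<omega>. l t \<omega> X \<partial>M) (\<lambda>X. X \<in> C) Kstar"
    and "K1 \<in> C"
    and ogd_init: "\<And>\<omega>. \<omega> \<in> space M \<Longrightarrow> K 1 \<omega> = K1"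
    and ogd_step: "\<And>t \<omega>. t \<in> {1..T} \<Longrightarrow> \<omega> \<in> space M \<Longrightarrow>
      K (Suc t) \<omega> = closest_point C (K t \<omega> - \<eta> t *\<^sub>R G t \<omega> (K t \<omega>))"
  shows "(\<integral>\<omega>. (\<Sum>t=1..T. l t \<omega> (K t \<omega>) - l t \<omega> Kstar) \<partial>M)
           \<le> 1 / 2 * (\<Sum>t=1..T. (b t)\<^sup>2 / (\<alpha> * real t))"
proof -
  interpret prob_space M by fact
  define f where "f t X = (\<integral>\<omega>. l t \<omega> X \<partial>M)" for t X
  define d where "d t = (\<integral>\<omega>. (norm (K t \<omega> - Kstar))\<^sup>2 \<partial>M)" for t
  from indep obtain F where sub: "\<And>t. t \<in> {1..T} \<Longrightarrow> subalgebra M (F t)"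
    and ind: "indep_sets (\<lambda>t. sets (F t)) {1..T}"
    and lG: "\<And>t. t \<in> {1..T} \<Longrightarrow>
      (\<lambda>(\<omega>, k). (l t \<omega> k, G t \<omega> k)) \<in> borel_measurable (F t \<Otimes>\<^sub>M borel)"
    unfolding indep_random_functions_def by blast
  have l: "(\<lambda>(\<omega>, k). l t \<omega> k) \<in> borel_measurable (F t \<Otimes>\<^sub>M borel)"
    and G: "(\<lambda>(\<omega>, k). G t \<omega> k) \<in> borel_measurable (F t \<Otimes>\<^sub>M borel)" if "t \<in> {1..T}" for t
    using measurable_compose[OF lG[OF that], of fst borel]
      measurable_compose[OF lG[OF that], of snd borel]
    by (simp_all add: case_prod_beta' borel_prod[symmetric])
  have Kstar: "Kstar \<in> C" using Kstar by (simp add: is_arg_min_def)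
  have C: "closed C" "bounded C" "C \<noteq> {}"
    using \<open>compact C\<close> \<open>K1 \<in> C\<close> by (auto intro: compact_imp_closed compact_imp_bounded)

  have KC: "K t \<omega> \<in> C" if "t \<in> {1..Suc T}" "\<omega> \<in> space M" for t \<omega>
  proof (cases "t = 1")
    case False
    with that have "t - 1 \<in> {1..T}" "Suc (t - 1) = t" by auto
    then show ?thesis
      using ogd_step[of "t - 1" \<omega>] that(2) closest_point_in_set[OF C(1,3)] by simp
  qed (use that ogd_init \<open>K1 \<in> C\<close> in simp)
  have subp: "\<And>i. i \<in> {1..<t} \<Longrightarrow> subalgebra M (F i)" if "t \<in> {1..Suc T}" for t
    using that sub by simp
  have K: "K t \<in> borel_measurable (joint_sigma F {1..<t})" if "t \<in> {1..Suc T}" for t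
    using that
  proof (induction t)
    case (Suc t)
    let ?A = "joint_sigma F {1..<Suc t}"
    have sp: "space ?A = space M" using Suc.prems by (intro space_joint subp)
    show ?case
    proof (cases "t = 0")
      case True
      then have "K (Suc t) \<in> borel_measurable ?A \<longleftrightarrow> (\<lambda>_. K1) \<in> borel_measurable ?A"
        using ogd_init sp by (intro measurable_cong) simp
      then show ?thesis by simp
    next
      case False
      with Suc.prems have t: "t \<in> {1..T}" by simp
      have Kt: "K t \<in> borel_measurable ?A"
        by (rule measurable_from_subalg[OF joint_mono[OF subp[OF Suc.prems]] Suc.IH]) (use t in auto)
      have "(\<lambda>\<omega>. \<omega>) \<in> ?A \<rightarrow>\<^sub>M F t"
        by (intro measurable_ident_subalg subalgebra_joint_source subp[OF Suc.prems]) (use t in auto)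
      from measurable_compose[OF measurable_Pair[OF this Kt] G[OF t]]
      have "(\<lambda>\<omega>. G t \<omega> (K t \<omega>)) \<in> borel_measurable ?A" by simp
      with Kt have "(\<lambda>\<omega>. K t \<omega> - \<eta> t *\<^sub>R G t \<omega> (K t \<omega>)) \<in> borel_measurable ?A" by measurable
      moreover have "closest_point C \<in> borel_measurable borel"
        using \<open>convex C\<close> C by (intro borel_measurable_continuous_onI continuous_on_closest_point)
      ultimately have "(\<lambda>\<omega>. closest_point C (K t \<omega> - \<eta> t *\<^sub>R G t \<omega> (K t \<omega>))) \<in> borel_measurable ?A"
        by (rule measurable_compose)
      also have "?this \<longleftrightarrow> K (Suc t) \<in> borel_measurable ?A"
        using ogd_step[OF t] sp by (intro measurable_cong) simp
      finally show ?thesis .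
    qed
  qed simp
  have KM: "K t \<in> borel_measurable M" if "t \<in> {1..Suc T}" for t
    by (rule measurable_from_subalg[OF subalgebra_joint[OF subp[OF that]] K[OF that]])

  have f_cont: "continuous_on UNIV (f t)" if "t \<in> {1..T}" for t
    using strongly_convex[OF that] unfolding strongly_convex_on_def f_def
    by (auto intro!: continuous_at_imp_continuous_on differentiable_imp_continuous_within)
  have f_int: "integrable M (\<lambda>\<omega>. f t (K t \<omega>) - f t Kstar)" if "t \<in> {1..T}" for t
    using that \<open>compact C\<close> KC
    by (intro Bochner_Integration.integrable_diff integrable_const
        integrable_continuous_compact[OF f_cont KM]) auto
  have d_int: "integrable M (\<lambda>\<omega>. (norm (K t \<omega> - Kstar))\<^sup>2)" if "t \<in> {1..Suc T}" for t
    by (rule integrable_continuous_compact[OF _ KM[OF that] \<open>compact C\<close>])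
       (use KC that in \<open>auto intro!: continuous_intros\<close>)

  have step: "(\<integral>\<omega>. f t (K t \<omega>) - f t Kstar \<partial>M)
      \<le> \<alpha> / 2 * ((real t - 1) * d t - real t * d (Suc t)) + 1 / 2 * ((b t)\<^sup>2 / (\<alpha> * real t))"
    if t: "t \<in> {1..T}" for t
  proof -
    from t have t': "t \<in> {1..Suc T}" "Suc t \<in> {1..Suc T}" "real t > 0" by auto
    have A: "subalgebra M (joint_sigma F {1..<t})" using t'(1) by (intro subalgebra_joint subp)
    have AB: "indep_set (sets (joint_sigma F {1..<t})) (sets (F t))"
      using t by (intro indep_joint_source[OF sub ind]) auto
    have KtC: "\<And>\<omega>. \<omega> \<in> space M \<Longrightarrow> K t \<omega> \<in> C" using KC t' by blast
    note freeze = A sub[OF t] AB G[OF t] K[OF t'(1)] KtC C(2) oracle_integrable[OF t]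
      oracle_sq_integrable[OF t, unfolded frob_norm_eq_norm]
      oracle_bounded_variance[OF t, unfolded frob_norm_eq_norm]
    let ?G = "\<lambda>\<omega>. G t \<omega> (K t \<omega>)"
    let ?grad = "\<lambda>\<omega>. \<integral>\<omega>'. G t \<omega>' (K t \<omega>) \<partial>M"
    have sq: "integrable M (\<lambda>\<omega>. (norm (?G \<omega>))\<^sup>2)" "(\<integral>\<omega>. (norm (?G \<omega>))\<^sup>2 \<partial>M) \<le> (b t)\<^sup>2"
      by (rule integrable_sq_freeze[OF freeze]; assumption)
         (rule integral_sq_freeze_le[OF freeze]; assumption)
    have G_int: "integrable M (\<lambda>\<omega>. inner (?G \<omega>) (K t \<omega> - Kstar))"
      by (rule integrable_inner_sample[OF freeze]; assumption)
    have grad_int: "integrable M (\<lambda>\<omega>. inner (?grad \<omega>) (K t \<omega> - Kstar))"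
      by (rule integrable_inner_mean[OF freeze]; assumption)
    have eq: "(\<integral>\<omega>. inner (?G \<omega>) (K t \<omega> - Kstar) \<partial>M) =
        (\<integral>\<omega>. inner (?grad \<omega>) (K t \<omega> - Kstar) \<partial>M)" (is "?I = _")
      by (rule integral_inner_freeze[OF freeze]; assumption)

    have "(\<integral>\<omega>. f t (K t \<omega>) - f t Kstar \<partial>M)
        \<le> (\<integral>\<omega>. inner (?grad \<omega>) (K t \<omega> - Kstar) - \<alpha> / 2 * (norm (K t \<omega> - Kstar))\<^sup>2 \<partial>M)"
    proof (rule integral_mono)
      fix \<omega> assume "\<omega> \<in> space M"
      then have "?grad \<omega> = matrix_deriv (f t) (K t \<omega>)"
        unfolding f_def using oracle_consistent[OF t] KtC by blast
      then show "f t (K t \<omega>) - f t Kstar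
          \<le> inner (?grad \<omega>) (K t \<omega> - Kstar) - \<alpha> / 2 * (norm (K t \<omega> - Kstar))\<^sup>2"
        using strongly_convex[OF t]
        unfolding strongly_convex_on_def frob_inner_eq_inner frob_norm_eq_norm f_def[symmetric]
        by simp
    qed (use f_int[OF t] grad_int d_int[OF t'(1)] in auto)
    also have "\<dots> = ?I - \<alpha> / 2 * d t"
      unfolding eq d_def using grad_int d_int[OF t'(1)] by simp
    finally have convex: "(\<integral>\<omega>. f t (K t \<omega>) - f t Kstar \<partial>M) \<le> ?I - \<alpha> / 2 * d t" .

    (* Multiplied by \<alpha> * t / 2, the expected one-step inequality has coefficient 1 at ?I. *)
    have "d (Suc t) \<le> (\<integral>\<omega>. (norm (K t \<omega> - Kstar))\<^sup>2
        - 2 * \<eta> t * inner (?G \<omega>) (K t \<omega> - Kstar) + (\<eta> t)\<^sup>2 * (norm (?G \<omega>))\<^sup>2 \<partial>M)"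
      unfolding d_def
    proof (rule integral_mono)
      show "(norm (K (Suc t) \<omega> - Kstar))\<^sup>2 \<le> (norm (K t \<omega> - Kstar))\<^sup>2
        - 2 * \<eta> t * inner (?G \<omega>) (K t \<omega> - Kstar) + (\<eta> t)\<^sup>2 * (norm (?G \<omega>))\<^sup>2"
        if "\<omega> \<in> space M" for \<omega>
        unfolding ogd_step[OF t that]
        by (rule projected_gradient_step[OF \<open>convex C\<close> C(1) Kstar])
    qed (use d_int[OF t'(1)] d_int[OF t'(2)] G_int sq(1) in auto)
    also have "\<dots> = d t - 2 * \<eta> t * ?I + (\<eta> t)\<^sup>2 * (\<integral>\<omega>. (norm (?G \<omega>))\<^sup>2 \<partial>M)"
      unfolding d_def using d_int[OF t'(1)] G_int sq(1) by simp
    also have "\<dots> \<le> d t - 2 * \<eta> t * ?I + (\<eta> t)\<^sup>2 * (b t)\<^sup>2"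
      using sq(2) by (simp add: mult_left_mono)
    finally have "\<alpha> * real t / 2 * (2 * \<eta> t * ?I)
        \<le> \<alpha> * real t / 2 * (d t - d (Suc t) + (\<eta> t)\<^sup>2 * (b t)\<^sup>2)"
      using \<open>\<alpha> > 0\<close> by (intro mult_left_mono) auto
    moreover have "\<alpha> * real t / 2 * (2 * \<eta> t * ?I) = ?I"
      using \<open>\<alpha> > 0\<close> t'(3) by (simp add: step_size[OF t])
    moreover have "\<alpha> * real t / 2 * ((\<eta> t)\<^sup>2 * (b t)\<^sup>2) = 1 / 2 * ((b t)\<^sup>2 / (\<alpha> * real t))"
      using \<open>\<alpha> > 0\<close> t'(3) by (simp add: step_size[OF t] power2_eq_square)
    ultimately have "?I \<le> \<alpha> * real t / 2 * (d t - d (Suc t)) + 1 / 2 * ((b t)\<^sup>2 / (\<alpha> * real t))"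
      by (simp only: distrib_left)
    moreover have "\<alpha> * real t / 2 * (d t - d (Suc t)) - \<alpha> / 2 * d t =
        \<alpha> / 2 * ((real t - 1) * d t - real t * d (Suc t))"
      by (simp add: field_simps)
    ultimately show ?thesis using convex by linarith
  qed

  have nonneg: "0 \<le> 1 / 2 * (\<Sum>t=1..T. (b t)\<^sup>2 / (\<alpha> * real t))"
    using \<open>\<alpha> > 0\<close> by (simp add: sum_nonneg)
  show ?thesis
  proof (cases "integrable M (\<lambda>\<omega>. \<Sum>t=1..T. l t \<omega> (K t \<omega>) - l t \<omega> Kstar)")
    case False
    (* The integral is 0 by convention. *)
    then show ?thesis using nonneg by (simp add: not_integrable_integral_eq)
  next
    case True
    let ?h = "\<lambda>t \<omega> X. l t \<omega> X - l t \<omega> Kstar"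
    have mean: "(\<integral>\<omega>. ?h t \<omega> X \<partial>M) = f t X - f t Kstar" if "t \<in> {1..T}" for t X
      using loss_integrable[OF that] by (simp add: f_def)
    have h: "(\<lambda>(\<omega>, X). ?h t \<omega> X) \<in> borel_measurable (F t \<Otimes>\<^sub>M borel)" if "t \<in> {1..T}" for t
    proof -
      have "(\<lambda>p. (fst p, Kstar)) \<in> F t \<Otimes>\<^sub>M borel \<rightarrow>\<^sub>M F t \<Otimes>\<^sub>M borel" by measurable
      from borel_measurable_diff[OF l[OF that] measurable_compose[OF this l[OF that]]]
      show ?thesis by (simp add: case_prod_beta')
    qed
    have "(\<integral>\<omega>. (\<Sum>t=1..T. l t \<omega> (K t \<omega>) - l t \<omega> Kstar) \<partial>M)
        = (\<Sum>t=1..T. \<integral>\<omega>. \<integral>\<omega>'. ?h t \<omega>' (K t \<omega>) \<partial>M \<partial>M)"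
    proof (rule integral_sum_freeze[OF sub ind h])
      show "K t \<in> borel_measurable (joint_sigma F {1..<t})" if "t \<in> {1..T}" for t
        using that by (intro K) simp
      show "integrable M (\<lambda>\<omega>. ?h t \<omega> X)" if "t \<in> {1..T}" for t X
        using loss_integrable[OF that] by (intro Bochner_Integration.integrable_diff)
      show "integrable M (\<lambda>\<omega>. \<integral>\<omega>'. ?h t \<omega>' (K t \<omega>) \<partial>M)" if "t \<in> {1..T}" for t
        unfolding mean[OF that] by (rule f_int[OF that])
    qed (assumption | rule True)+
    also have "\<dots> = (\<Sum>t=1..T. \<integral>\<omega>. f t (K t \<omega>) - f t Kstar \<partial>M)"
      by (intro sum.cong refl) (simp add: mean)
    also have "\<dots> \<le> (\<Sum>t=1..T. \<alpha> / 2 * ((real t - 1) * d t - real t * d (Suc t))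
        + 1 / 2 * ((b t)\<^sup>2 / (\<alpha> * real t)))"
      by (intro sum_mono step)
    also have "\<dots> = \<alpha> / 2 * (\<Sum>t=1..T. (real t - 1) * d t - real t * d (Suc t))
        + 1 / 2 * (\<Sum>t=1..T. (b t)\<^sup>2 / (\<alpha> * real t))"
      by (simp only: sum.distrib sum_distrib_left)
    also have "\<dots> = \<alpha> / 2 * (- real T * d (Suc T)) + 1 / 2 * (\<Sum>t=1..T. (b t)\<^sup>2 / (\<alpha> * real t))"
      by (simp only: sum_weighted_telescope)
    also have "\<dots> \<le> 1 / 2 * (\<Sum>t=1..T. (b t)\<^sup>2 / (\<alpha> * real t))"
    proof -
      have "0 \<le> d (Suc T)" unfolding d_def by simp
      then show ?thesis using \<open>\<alpha> > 0\<close> by simp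
    qed
    finally show ?thesis .
  qed
qed

end
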